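(* Let $f:(a,b)\to\mathbb{R}$ be a continuously differentiable uniformly convex function with modulus $\Phi:[0,b-a]\to[0,\infty)$. Let $x_1,\dots,x_n\in(a,b)$, let $(a_1,\dots,a_n)$ be a nonnegative $n$-tuple with $A_n=\sum_{i=1}^n a_i>0$, and let $\overline{x}=\frac{1}{A_n}\sum_{i=1}^n a_ix_i$. Then $$\frac{1}{A_n}\sum_{i=1}^n a_if(x_i)-f(\overline{x})\le\frac{1}{A_n}\sum_{i=1}^n a_if'(x_i)(x_i-\overline{x})-\frac{1}{A_n}\sum_{i=1}^n a_i\Phi(|\overline{x}-x_i|).$$
   Context: A function $f$ on an interval with endpoints $a<b$ is uniformly convex with modulus $\Phi:[0,b-a]\to[0,\infty)$ if $tf(x)+(1-t)f(y)\ge f(tx+(1-t)y)+t(1-t)\Phi(|x-y|)$ for all $x,y$ in the interval and all $t\in[0,1]$. By standing convention the modulus $\Phi$ is increasing with $\Phi(0)=0$. *)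

theory Defs
  imports "HOL-Analysis.Analysis"
begin

text \<open>
  A modulus is a function from \<open>[0, d]\<close> to \<open>[0, \<infinity>)\<close>; here it is a total function on the reals
  whose values outside \<open>[0, d]\<close> are irrelevant. Increasing is understood in the weak sense.
\<close>

definition convexity_modulus :: "real \<Rightarrow> (real \<Rightarrow> real) \<Rightarrow> bool" where
  "convexity_modulus d \<Phi> \<longleftrightarrow>
     \<Phi> \<in> {0..d} \<rightarrow> {0..} \<and> mono_on {0..d} \<Phi> \<and> \<Phi> 0 = 0"

text \<open>
  For an interval \<open>I\<close> with endpoints \<open>a < b\<close>, the function \<open>\<Phi>\<close> is meant to satisfy
  \<open>convexity_modulus (b - a) \<Phi>\<close>; only its values on \<open>[0, b - a]\<close> enter below.
\<close>

definition uniformly_convex_on :: "real set \<Rightarrow> (real \<Rightarrow> real) \<Rightarrow> (real \<Rightarrow> real) \<Rightarrow> bool" where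
  "uniformly_convex_on I \<Phi> f \<longleftrightarrow>
     (\<forall>x\<in>I. \<forall>y\<in>I. \<forall>t\<in>{0..1}.
        t * f x + (1 - t) * f y \<ge> f (t * x + (1 - t) * y) + t * (1 - t) * \<Phi> \<bar>x - y\<bar>)"

end

theory Submission
  imports Defs
begin

text \<open>
  Dividing the defining inequality at \<open>x + t (y - x)\<close> by \<open>t\<close> and letting \<open>t \<rightarrow> 0+\<close> strengthens the
  tangent line inequality by \<open>\<Phi> \<bar>y - x\<bar>\<close>. Applying this at each \<open>x\<^sub>i\<close> with \<open>y\<close> the weighted mean and
  averaging gives the theorem.
\<close>

lemma uniformly_convex_on_tangent:
  assumes uc: "uniformly_convex_on I \<Phi> f"
    and xy: "x \<in> I" "y \<in> I"
    and df: "(f has_real_derivative D) (at x)"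
  shows "f x + D * (y - x) + \<Phi> \<bar>y - x\<bar> \<le> f y"
proof -
  let ?g = "\<lambda>t. f (x + t * (y - x))"
  have "(?g has_real_derivative D * (y - x)) (at 0)"
    using df by (auto intro!: derivative_eq_intros DERIV_chain2[where f = f])
  \<comment> \<open>Only the limit from the right is kept: uniform convexity will bound this
    quotient for \<open>t\<close> in (0, 1) only.\<close>
  then have "((\<lambda>t. (?g t - f x) / t) \<longlongrightarrow> D * (y - x)) (at_right 0)"
    by (auto simp: DERIV_def intro: tendsto_within_subset)
  \<comment> \<open>The factor \<open>1 - t\<close> is what remains of \<open>t * (1 - t)\<close>
    after division by \<open>t\<close>; it tends to 1, so the full modulus survives in the limit.
    The unsimplified \<open>1 - 0\<close> matches the shape given by
    \<open>tendsto_intros\<close>.\<close>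
  then have lim: "((\<lambda>t. (?g t - f x) / t + (1 - t) * \<Phi> \<bar>y - x\<bar>)
      \<longlongrightarrow> D * (y - x) + (1 - 0) * \<Phi> \<bar>y - x\<bar>) (at_right 0)"
    by (intro tendsto_intros)
  have quot: "(?g t - f x) / t + (1 - t) * \<Phi> \<bar>y - x\<bar> \<le> f y - f x" if t: "0 < t" "t < 1" for t
  proof -
    \<comment> \<open>The definition is used for the pair \<open>y\<close>, \<open>x\<close> in this
      order, so that the small weight \<open>t\<close> falls on \<open>y\<close> and the point stays
      near \<open>x\<close>.\<close>
    have "f (t * y + (1 - t) * x) + t * (1 - t) * \<Phi> \<bar>y - x\<bar> \<le> t * f y + (1 - t) * f x"
      using uc xy t unfolding uniformly_convex_on_def by auto
    moreover have "t * y + (1 - t) * x = x + t * (y - x)"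
      by (simp add: algebra_simps)
    ultimately have "?g t - f x + t * ((1 - t) * \<Phi> \<bar>y - x\<bar>) \<le> t * (f y - f x)"
      by (simp add: algebra_simps)
    then show ?thesis
      using t by (simp add: field_simps)
  qed
  have "\<forall>\<^sub>F t in at_right 0. (?g t - f x) / t + (1 - t) * \<Phi> \<bar>y - x\<bar> \<le> f y - f x"
    using eventually_at_right_real[of 0 1] by (rule eventually_mono) (auto intro: quot)
  with lim have "D * (y - x) + (1 - 0) * \<Phi> \<bar>y - x\<bar> \<le> f y - f x"
    by (rule tendsto_upperbound) simp_all
  then show ?thesis
    by simp
qed

theorem theorem9:
  fixes f \<Phi> :: "real \<Rightarrow> real"
    and a b :: real
    and n :: nat
    and x w :: "nat \<Rightarrow> real"
    and A xbar :: real
  assumes "a < b"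
    and "f C1_differentiable_on {a<..<b}"
    and "convexity_modulus (b - a) \<Phi>"
    and "uniformly_convex_on {a<..<b} \<Phi> f"
    and "\<And>i. i \<in> {1..n} \<Longrightarrow> x i \<in> {a<..<b}"
    and "\<And>i. i \<in> {1..n} \<Longrightarrow> w i \<ge> 0"
    and "A = (\<Sum>i=1..n. w i)"
    and "A > 0"
    and "xbar = 1 / A * (\<Sum>i=1..n. w i * x i)"
  shows "1 / A * (\<Sum>i=1..n. w i * f (x i)) - f xbar
    \<le> 1 / A * (\<Sum>i=1..n. w i * deriv f (x i) * (x i - xbar))
      - 1 / A * (\<Sum>i=1..n. w i * \<Phi> \<bar>xbar - x i\<bar>)"
proof -
  \<comment> \<open>The normalised weights sum to 1, so the mean stays in the convex set
    \<open>{a<..<b}\<close> and can serve as the second point of the tangent inequality at each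
    \<open>x i\<close>.\<close>
  have "(\<Sum>i=1..n. (w i / A) *\<^sub>R x i) \<in> {a<..<b}"
    using assms by (intro convex_sum) (auto simp flip: sum_divide_distrib)
  then have xbar: "xbar \<in> {a<..<b}"
    using assms(9) by (simp add: sum_divide_distrib)
  have "w i * (f (x i) + deriv f (x i) * (xbar - x i) + \<Phi> \<bar>xbar - x i\<bar>) \<le> w i * f xbar"
    if i: "i \<in> {1..n}" for i
  proof -
    have "f differentiable at (x i)"
      using assms(2,5) i by (auto simp: C1_differentiable_on_eq)
    then have "(f has_real_derivative deriv f (x i)) (at (x i))"
      by (simp add: DERIV_deriv_iff_real_differentiable)
    from uniformly_convex_on_tangent[OF assms(4) assms(5)[OF i] xbar this]
    show ?thesis
      using assms(6)[OF i] by (rule mult_left_mono)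
  qed
  \<comment> \<open>Writing \<open>x i - xbar\<close> for \<open>xbar - x i\<close> flips the sign
    of the derivative term, which therefore ends up in the upper bound.\<close>
  then have "(\<Sum>i=1..n. w i * f (x i) - w i * deriv f (x i) * (x i - xbar) + w i * \<Phi> \<bar>xbar - x i\<bar>)
      \<le> (\<Sum>i=1..n. w i * f xbar)"
    by (intro sum_mono) (simp add: algebra_simps)
  then have "(\<Sum>i=1..n. w i * f (x i)) - (\<Sum>i=1..n. w i * deriv f (x i) * (x i - xbar))
      + (\<Sum>i=1..n. w i * \<Phi> \<bar>xbar - x i\<bar>) \<le> A * f xbar"
    by (simp add: sum.distrib sum_subtractf assms(7) sum_distrib_right)
  then have "((\<Sum>i=1..n. w i * f (x i)) - (\<Sum>i=1..n. w i * deriv f (x i) * (x i - xbar))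
      + (\<Sum>i=1..n. w i * \<Phi> \<bar>xbar - x i\<bar>)) / A \<le> f xbar"
    using \<open>A > 0\<close> by (simp only: pos_divide_le_eq mult.commute)
  then show ?thesis
    by (simp add: add_divide_distrib diff_divide_distrib)
qed

end
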